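(* Let $S$ be an additively reduced and additively atomic semidomain. The following statements are equivalent: (1) $\mathcal{A}_{+}(S) = S^{\times}$; (2) every $f \in S\llbracket x^{\pm 1} \rrbracket$ with $|\mathrm{supp}(f)| > 1$ can be expressed as the sum of at most three multiplicative irreducibles of $S\llbracket x^{\pm 1} \rrbracket$; (3) there exists a positive integer $k$ such that every $f \in S\llbracket x^{\pm 1}\rrbracket$ with $|\mathrm{supp}(f)| > 1$ can be expressed as the sum of at most $k$ multiplicative irreducibles of $S\llbracket x^{\pm 1} \rrbracket$.
   Context: A semidomain is a subsemiring of an integral domain, i.e., a subset $S$ of an integral domain containing $0$ and $1$ and closed under addition and multiplication. $S^{\times}$ denotes the group of units of the multiplicative monoid $S^* = S\setminus\{0\}$ (elements having a multiplicative inverse in $S$). $\mathcal{A}_{+}(S)$ is the set of atoms of the additive monoid $(S,+)$: elements $a$ that are not additively invertible in $S$ and such that $a = b + c$ with $b, c \in S$ implies that $b$ or $c$ is additively invertible in $S$. $S$ is additively reduced if $0$ is the only invertible element of $(S,+)$. $S$ is additively atomic if every non-invertible element of $(S,+)$ is a sum of finitely many atoms of $(S,+)$. $S\llbracket x^{\pm 1} \rrbracket$ is the semidomain of formal Laurent series with coefficients in $S$ and only finitely many terms with negative exponent; $\mathrm{supp}(f)$ is the set of exponents of $f$ with nonzero coefficient. A multiplicative irreducible of a semidomain $T$ is a nonzero non-unit $a \in T$ such that $a = bc$ with $b, c \in T$ implies $b \in T^{\times}$ or $c \in T^{\times}$. *)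

theory Defs
  imports "HOL-Computational_Algebra.Formal_Laurent_Series"
begin

text \<open>
  The ambient integral domain is a type of class \<^class>\<open>idom\<close>, and a semidomain is a subset of it.
  The notions below are stated for an arbitrary subset, so that they apply both to a semidomain
  \<open>S\<close> and to the semidomain of Laurent series over \<open>S\<close>.
\<close>

definition semidomain :: "'a::idom set \<Rightarrow> bool" where
  "semidomain S \<longleftrightarrow> 0 \<in> S \<and> 1 \<in> S \<and> (\<forall>a\<in>S. \<forall>b\<in>S. a + b \<in> S) \<and> (\<forall>a\<in>S. \<forall>b\<in>S. a * b \<in> S)"

definition mult_units :: "'a::idom set \<Rightarrow> 'a set" where
  "mult_units S = {u \<in> S - {0}. \<exists>v \<in> S - {0}. u * v = 1}"

definition add_invertible :: "'a::idom set \<Rightarrow> 'a \<Rightarrow> bool" where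
  "add_invertible S a \<longleftrightarrow> a \<in> S \<and> (\<exists>b\<in>S. a + b = 0)"

definition add_atoms :: "'a::idom set \<Rightarrow> 'a set" where
  "add_atoms S = {a \<in> S. \<not> add_invertible S a \<and>
     (\<forall>b\<in>S. \<forall>c\<in>S. a = b + c \<longrightarrow> add_invertible S b \<or> add_invertible S c)}"

definition add_reduced :: "'a::idom set \<Rightarrow> bool" where
  "add_reduced S \<longleftrightarrow> {a. add_invertible S a} = {0}"

definition add_atomic :: "'a::idom set \<Rightarrow> bool" where
  "add_atomic S \<longleftrightarrow>
     (\<forall>a\<in>S. \<not> add_invertible S a \<longrightarrow> (\<exists>as. set as \<subseteq> add_atoms S \<and> a = sum_list as))"

definition mult_irreducibles :: "'a::idom set \<Rightarrow> 'a set" where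
  "mult_irreducibles T = {a \<in> T. a \<noteq> 0 \<and> a \<notin> mult_units T \<and>
     (\<forall>b\<in>T. \<forall>c\<in>T. a = b * c \<longrightarrow> b \<in> mult_units T \<or> c \<in> mult_units T)}"

definition laurent_series :: "'a::idom set \<Rightarrow> 'a fls set" where
  "laurent_series S = {f. \<forall>n. fls_nth f n \<in> S}"

definition fls_supp :: "'a::idom fls \<Rightarrow> int set" where
  "fls_supp f = {n. fls_nth f n \<noteq> 0}"

text \<open>
  The support of a Laurent series may be infinite, in which case \<^const>\<open>card\<close> returns \<open>0\<close>; hence
  the disjunction below.
\<close>

definition supp_gt_one :: "'a::idom fls \<Rightarrow> bool" where
  "supp_gt_one f \<longleftrightarrow> infinite (fls_supp f) \<or> card (fls_supp f) > 1"

text \<open>Summands may repeat, hence lists rather than sets.\<close>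

definition sum_of_at_most_irreducibles :: "nat \<Rightarrow> 'a::idom set \<Rightarrow> 'a \<Rightarrow> bool" where
  "sum_of_at_most_irreducibles k T f \<longleftrightarrow>
     (\<exists>gs. length gs \<le> k \<and> set gs \<subseteq> mult_irreducibles T \<and> f = sum_list gs)"

lemma semidomain_sum:
  assumes "semidomain S" "\<And>i. i \<in> A \<Longrightarrow> g i \<in> S"
  shows "sum g A \<in> S"
  using assms by (induction A rule: infinite_finite_induct) (auto simp: semidomain_def)

lemma semidomain_laurent_series:
  assumes "semidomain S"
  shows "semidomain (laurent_series S)"
proof -
  have "fls_nth (f * g) n \<in> S" if "f \<in> laurent_series S" "g \<in> laurent_series S" for f g n
    using that assms
    by (auto simp: fls_times_nth(1) laurent_series_def semidomain_def intro!: semidomain_sum)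
  then show ?thesis
    using assms by (auto simp: semidomain_def laurent_series_def)
qed

end

theory Submission
  imports Defs
begin

text \<open>
  Since \<open>S\<close> is additively reduced, nothing cancels in a product of Laurent series, so supports add
  as sets: a series with some unit coefficient is irreducible as soon as its support is not a sum
  of two sets of at least two integers each. If all atoms are units, every nonzero
  coefficient is a unit plus a remainder in \<open>S\<close>, and it remains to distribute the support of \<open>f\<close>
  over at most three such indecomposable sets, a remainder going to a different set than its unit.

  A set with minimum \<open>m\<close> is indecomposable if it has a far away element \<open>N\<close> (all others being below
  the midpoint of \<open>m\<close> and \<open>N\<close>), or if the gap \<open>d\<close> between its first two elements occurs as a
  difference only once. A finite support is cut at its midpoint, the lower part taking the maximum
  and the upper part taking the minimum; a trinomial with unit coefficients is itself irreducible,
  because a product with a three-term arithmetic progression as support has a sum of two nonzero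
  terms, not an atom, as its middle coefficient. For an infinite support and two of its elements \<open>p\<close> and
  \<open>p + d\<close>: if the difference \<open>d\<close> occurs only finitely often, then \<open>p\<close>, \<open>p + d\<close> and the tail form one
  set; otherwise, given a later pair \<open>q\<close>, \<open>q + d\<close>, the tail is divided between the two pairs by the
  parity of \<open>n div d\<close>. The finitely many other elements are joined with a far away one.

  Conversely, units are always atoms. If \<open>a\<close> is an atom, then in any finite decomposition of the series
  with all coefficients \<open>a\<close> some summand has infinite support and is \<open>a\<close> times a series with
  coefficients \<open>0\<close> and \<open>1\<close>; when it is irreducible, \<open>a\<close> is a unit.
\<close>

section \<open>Sums, atoms and units in an additively reduced semidomain\<close>

locale reduced_semidomain =
  fixes S :: "'a::idom set"
  assumes semidomain: "semidomain S" and reduced: "add_reduced S"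
begin

lemma zero_mem [simp]: "0 \<in> S" and one_mem [simp]: "1 \<in> S"
  and add_mem: "a \<in> S \<Longrightarrow> b \<in> S \<Longrightarrow> a + b \<in> S"
  and mult_mem: "a \<in> S \<Longrightarrow> b \<in> S \<Longrightarrow> a * b \<in> S"
  using semidomain by (auto simp: semidomain_def)

lemma sum_list_mem: "set xs \<subseteq> S \<Longrightarrow> sum_list xs \<in> S"
  by (induction xs) (auto intro: add_mem)

lemma add_invertible_iff: "add_invertible S a \<longleftrightarrow> a = 0"
  using reduced by (auto simp: add_reduced_def)

lemma add_eq_0_iff: "a \<in> S \<Longrightarrow> b \<in> S \<Longrightarrow> a + b = 0 \<longleftrightarrow> a = 0 \<and> b = 0"
  using add_invertible_iff[of a] by (auto simp: add_invertible_def)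

lemma sum_eq_0_iff:
  assumes "finite A" "\<And>i. i \<in> A \<Longrightarrow> g i \<in> S"
  shows "sum g A = 0 \<longleftrightarrow> (\<forall>i\<in>A. g i = 0)"
  using assms
proof (induction A rule: finite_induct)
  case (insert x A)
  then have "sum g A \<in> S"
    by (intro semidomain_sum[OF semidomain]) auto
  with insert show ?case
    by (simp add: add_eq_0_iff)
qed simp

lemma add_atoms_iff:
  "a \<in> add_atoms S \<longleftrightarrow> a \<in> S \<and> a \<noteq> 0 \<and> (\<forall>b\<in>S. \<forall>c\<in>S. a = b + c \<longrightarrow> b = 0 \<or> c = 0)"
  by (auto simp: add_atoms_def add_invertible_iff)

lemma mult_units_iff: "u \<in> mult_units S \<longleftrightarrow> u \<in> S \<and> (\<exists>v\<in>S. u * v = 1)"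
  unfolding mult_units_def by force

text \<open>Atomicity applied to \<open>1\<close> provides some atom \<open>a\<close>. If
  \<open>u = b + c\<close> and \<open>u * v = 1\<close>, then
  \<open>a = a * v * b + a * v * c\<close>, so one of these terms vanishes, and cancelling the
  nonzero \<open>a\<close> and \<open>v\<close> leaves \<open>b = 0\<close> or
  \<open>c = 0\<close>.\<close>

lemma units_subset_atoms:
  assumes "add_atomic S"
  shows "mult_units S \<subseteq> add_atoms S"
proof
  fix u assume "u \<in> mult_units S"
  then obtain v where u: "u \<in> S" "v \<in> S" "u * v = 1"
    by (auto simp: mult_units_iff)
  obtain as where as: "set as \<subseteq> add_atoms S" "1 = sum_list as"
    using assms unfolding add_atomic_def add_invertible_iff by (metis one_mem one_neq_zero)
  then obtain a where a: "a \<in> add_atoms S"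
    by (cases as) auto
  have "b = 0 \<or> c = 0" if "b \<in> S" "c \<in> S" "u = b + c" for b c
  proof -
    have "a = a * v * b + a * v * c"
      using u(3) that(3) by (metis distrib_left mult.assoc mult.commute mult.right_neutral)
    then have "a * v * b = 0 \<or> a * v * c = 0"
      using a u that unfolding add_atoms_iff by (meson mult_mem)
    then show ?thesis
      using a u by (auto simp: add_atoms_iff)
  qed
  then show "u \<in> add_atoms S"
    using u by (auto simp: add_atoms_iff)
qed

section \<open>Supports of products, and units among the Laurent series\<close>

text \<open>Every nonzero term of the convolution lies in the finite summation range of
  \<open>fls_times_nth(2)\<close>, so that range can be traded for all integers.\<close>

lemma nonzero_mem_interval:
  assumes "fls_nth f i \<noteq> 0" "fls_nth g (n - i) \<noteq> 0"
  shows "i \<in> {fls_subdegree f..n - fls_subdegree g}"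
  using fls_subdegree_leI[OF assms(1)] fls_subdegree_leI[OF assms(2)] by simp

lemma nth_mult_eq_0_iff:
  assumes "f \<in> laurent_series S" "g \<in> laurent_series S"
  shows "fls_nth (f * g) n = 0 \<longleftrightarrow> (\<forall>i. fls_nth f i = 0 \<or> fls_nth g (n - i) = 0)"
proof -
  have "fls_nth (f * g) n = 0 \<longleftrightarrow>
      (\<forall>i\<in>{fls_subdegree f..n - fls_subdegree g}. fls_nth f i * fls_nth g (n - i) = 0)"
    unfolding fls_times_nth(2)
    by (rule sum_eq_0_iff) (use assms in \<open>auto simp: laurent_series_def mult_mem\<close>)
  also have "\<dots> \<longleftrightarrow> (\<forall>i. fls_nth f i = 0 \<or> fls_nth g (n - i) = 0)"
    unfolding mult_eq_0_iff using nonzero_mem_interval[of f _ g n] by blast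
  finally show ?thesis .
qed

lemma supp_mult:
  assumes "f \<in> laurent_series S" "g \<in> laurent_series S"
  shows "fls_supp (f * g) = {i + j |i j. i \<in> fls_supp f \<and> j \<in> fls_supp g}"
  using nth_mult_eq_0_iff[OF assms] unfolding fls_supp_def
  by auto (metis add_diff_cancel_left' add.commute diff_add_cancel)+

text \<open>Both \<open>i\<close> and \<open>i'\<close> contribute nonzero terms to the same
  coefficient. Splitting off the first leaves a rest that contains the second and is therefore
  nonzero, so the coefficient is a sum of two nonzero elements of \<open>S\<close>.\<close>

lemma nth_mult_not_atom:
  assumes "f \<in> laurent_series S" "g \<in> laurent_series S" "i + j = i' + j'" "i \<noteq> i'"
    and "i \<in> fls_supp f" "i' \<in> fls_supp f" "j \<in> fls_supp g" "j' \<in> fls_supp g"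
  shows "fls_nth (f * g) (i + j) \<notin> add_atoms S"
proof
  assume atom: "fls_nth (f * g) (i + j) \<in> add_atoms S"
  let ?t = "\<lambda>k. fls_nth f k * fls_nth g (i + j - k)"
  let ?I = "{fls_subdegree f..i + j - fls_subdegree g}"
  have eq: "i + j - i = j" "i + j - i' = j'"
    using assms(3) by simp_all
  have "i \<in> ?I" "i' \<in> ?I"
    using nonzero_mem_interval[of f i g "i + j"] nonzero_mem_interval[of f i' g "i + j"] assms(5-8)
    unfolding eq by (simp_all add: fls_supp_def)
  then have "fls_nth (f * g) (i + j) = ?t i + (\<Sum>k\<in>?I - {i}. ?t k)"
    unfolding fls_times_nth(2) by (intro sum.remove) auto
  moreover have S: "?t k \<in> S" for k
    using assms by (auto simp: laurent_series_def mult_mem)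
  moreover have sumS: "(\<Sum>k\<in>?I - {i}. ?t k) \<in> S"
    by (intro semidomain_sum[OF semidomain] S)
  ultimately have "?t i = 0 \<or> (\<Sum>k\<in>?I - {i}. ?t k) = 0"
    using atom unfolding add_atoms_iff by blast
  moreover have "?t i \<noteq> 0" "?t i' \<noteq> 0"
    using assms eq by (auto simp: fls_supp_def)
  moreover have "(\<Sum>k\<in>?I - {i}. ?t k) = 0 \<longleftrightarrow> (\<forall>k\<in>?I - {i}. ?t k = 0)"
    by (rule sum_eq_0_iff) (use S in auto)
  ultimately show False
    using \<open>i' \<in> ?I\<close> \<open>i \<noteq> i'\<close> by blast
qed

text \<open>The supports of \<open>u\<close> and of its inverse add up to \<open>{0}\<close>, so a
  fixed exponent \<open>j\<close> of the inverse determines every exponent of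
  \<open>u\<close>.\<close>

lemma supp_unit:
  assumes "u \<in> mult_units (laurent_series S)"
  shows "is_singleton (fls_supp u)"
proof -
  obtain v where uv: "u \<in> laurent_series S" "v \<in> laurent_series S" "u * v = 1" "u \<noteq> 0" "v \<noteq> 0"
    using assms by (auto simp: mult_units_def)
  have eq: "{i + j |i j. i \<in> fls_supp u \<and> j \<in> fls_supp v} = {0}"
    unfolding supp_mult[OF uv(1,2), symmetric] uv(3) by (auto simp: fls_supp_def)
  obtain j where j: "j \<in> fls_supp v" and "fls_supp u \<noteq> {}"
    using uv(4,5) fls_nonzeroI by (auto simp: fls_supp_def fls_eq_iff)
  moreover have "i + j = 0" if "i \<in> fls_supp u" for i
    using eq that j by blast
  ultimately show ?thesis
    by (metis is_singletonI' add_right_cancel)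
qed

text \<open>Every coefficient of \<open>b * c\<close> is a multiple of the only coefficient
  \<open>s\<close> of \<open>b\<close>. If one of them is a unit, so is \<open>s\<close>, and the
  monomial can be inverted.\<close>

lemma monomial_unit:
  assumes b: "b \<in> laurent_series S" "is_singleton (fls_supp b)"
    and c: "c \<in> laurent_series S" and unit: "fls_nth (b * c) n \<in> mult_units S"
  shows "b \<in> mult_units (laurent_series S)"
proof -
  obtain j where j: "fls_supp b = {j}"
    using b(2) by (auto elim: is_singletonE)
  define s where "s = fls_nth b j"
  \<comment> \<open>\<open>fls_shift (-j)\<close> multiplies by the \<open>j\<close>-th power of the
    variable.\<close>
  have b_eq: "b = fls_shift (-j) (fls_const s)"
    using j by (auto simp: fls_eq_iff fls_supp_def s_def)
  then have "fls_nth (b * c) n = s * fls_nth c (n - j)"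
    by (simp add: fls_shifted_times_simps)
  then obtain v where v: "v \<in> S" "s * (fls_nth c (n - j) * v) = 1"
    using unit by (auto simp: mult_units_iff mult.assoc)
  define w where "w = fls_nth c (n - j) * v"
  have w: "w \<in> S" "s * w = 1"
    using v c by (auto simp: w_def laurent_series_def mult_mem)
  have prod: "b * fls_shift j (fls_const w) = 1"
    unfolding b_eq fls_times_both_shifted_simp using w by (simp add: fls_const_mult_const)
  moreover have "fls_shift j (fls_const w) \<in> laurent_series S"
    using w by (auto simp: laurent_series_def)
  moreover have "b \<noteq> 0" "fls_shift j (fls_const w) \<noteq> 0"
    using prod by auto
  ultimately show ?thesis
    using b(1) unfolding mult_units_def by blast
qed

text \<open>Reduces irreducibility to a question about supports: the unit coefficient turns any
  monomial factor into a unit.\<close>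

lemma irreducibleI:
  assumes "g \<in> laurent_series S" "\<not> is_singleton (fls_supp g)" "fls_nth g n \<in> mult_units S"
    and "\<And>b c. b \<in> laurent_series S \<Longrightarrow> c \<in> laurent_series S \<Longrightarrow> g = b * c \<Longrightarrow>
           is_singleton (fls_supp b) \<or> is_singleton (fls_supp c)"
  shows "g \<in> mult_irreducibles (laurent_series S)"
  unfolding mult_irreducibles_def
proof (intro CollectI conjI ballI impI)
  show "g \<noteq> 0"
    using assms(3) by (auto simp: mult_units_def)
  show "g \<notin> mult_units (laurent_series S)"
    using supp_unit assms(2) by blast
  show "b \<in> mult_units (laurent_series S) \<or> c \<in> mult_units (laurent_series S)"
    if "b \<in> laurent_series S" "c \<in> laurent_series S" "g = b * c" for b c
    using assms(3,4) that monomial_unit[of b c n] monomial_unit[of c b n] by (auto simp: mult.commute)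
qed (use assms in auto)

section \<open>From bounded sums of irreducibles to atoms being units\<close>

lemma atoms_subset_units:
  assumes sums: "\<forall>f \<in> laurent_series S. supp_gt_one f \<longrightarrow>
    sum_of_at_most_irreducibles k (laurent_series S) f"
  shows "add_atoms S \<subseteq> mult_units S"
proof (rule ccontr)
  assume "\<not> add_atoms S \<subseteq> mult_units S"
  then obtain a where atom: "a \<in> add_atoms S" and nonunit: "a \<notin> mult_units S"
    by blast
  then have a: "a \<in> S" "a \<noteq> 0" "\<And>b c. b \<in> S \<Longrightarrow> c \<in> S \<Longrightarrow> a = b + c \<Longrightarrow> b = 0 \<or> c = 0"
    by (auto simp: add_atoms_iff)
  define f where "f = Abs_fls (\<lambda>n::int. if n < 0 then 0 else a)"
  have f_nth: "fls_nth f n = (if n < 0 then 0 else a)" for n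
    unfolding f_def by (subst nth_Abs_fls_lower_bound[of 0]) auto
  have supp: "fls_supp f = {0..}"
    using a by (auto simp: fls_supp_def f_nth)
  have "f \<in> laurent_series S" "supp_gt_one f"
    using a by (auto simp: laurent_series_def f_nth supp_gt_one_def supp infinite_Ici)
  then obtain gs where gs: "set gs \<subseteq> mult_irreducibles (laurent_series S)" "f = sum_list gs"
    using sums unfolding sum_of_at_most_irreducibles_def by blast
  have nth_sum: "fls_nth (sum_list hs) n = (\<Sum>h\<leftarrow>hs. fls_nth h n)" for hs :: "'a fls list" and n
    by (induction hs) auto
  have "fls_supp f \<subseteq> (\<Union>g\<in>set gs. fls_supp g)"
  proof
    fix n assume "n \<in> fls_supp f"
    then have "(\<Sum>g\<leftarrow>gs. fls_nth g n) \<noteq> 0"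
      by (simp add: fls_supp_def gs nth_sum)
    then show "n \<in> (\<Union>g\<in>set gs. fls_supp g)"
      unfolding fls_supp_def by (induction gs) auto
  qed
  then have "infinite (\<Union>g\<in>set gs. fls_supp g)"
    using supp infinite_Ici finite_subset by metis
  then obtain g where g: "g \<in> set gs" "infinite (fls_supp g)"
    by auto
  have irr: "g \<in> mult_irreducibles (laurent_series S)"
    using gs g by auto
  have mem: "fls_nth h n \<in> S" if "h \<in> set gs" for h n
    using gs that by (auto simp: mult_irreducibles_def laurent_series_def)
  \<comment> \<open>From exponent \<open>0\<close> on, \<open>a\<close> is the coefficient of
    \<open>g\<close> plus a rest in \<open>S\<close>, and one of the two is \<open>0\<close> because
    \<open>a\<close> is an atom. At negative exponents the total is \<open>0\<close>, so both
    vanish.\<close>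
  have coeff: "fls_nth g n = 0 \<or> fls_nth g n = a" for n
  proof -
    have "f = g + sum_list (remove1 g gs)"
      using g gs by (simp add: sum_list_map_remove1[of g gs id, simplified])
    then have eq: "fls_nth f n = fls_nth g n + (\<Sum>h\<leftarrow>remove1 g gs. fls_nth h n)"
      by (simp add: nth_sum)
    have rest: "(\<Sum>h\<leftarrow>remove1 g gs. fls_nth h n) \<in> S"
      using mem notin_set_remove1 by (intro sum_list_mem) fastforce
    show ?thesis
      using eq rest mem[OF g(1), of n] a(3)[OF mem[OF g(1)] rest]
      by (auto simp: f_nth add_eq_0_iff split: if_splits)
  qed
  define h where "h = Abs_fls (\<lambda>n. if fls_nth g n = 0 then 0 else 1 :: 'a)"
  have h_nth: "fls_nth h n = (if fls_nth g n = 0 then 0 else 1)" for n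
    unfolding h_def by (subst nth_Abs_fls_lower_bound[of "fls_subdegree g"]) auto
  have "g = fls_const a * h"
    using coeff by (auto simp: fls_eq_iff h_nth)
  moreover have "h \<in> laurent_series S" "fls_const a \<in> laurent_series S"
    using a by (auto simp: laurent_series_def h_nth)
  ultimately consider "h \<in> mult_units (laurent_series S)" | "fls_const a \<in> mult_units (laurent_series S)"
    using irr unfolding mult_irreducibles_def by blast
  then show False
  proof cases
    case 1
    moreover have "fls_supp h = fls_supp g"
      by (auto simp: fls_supp_def h_nth)
    ultimately show False
      using supp_unit g(2) by (metis finite.simps is_singletonE)
  next
    case 2
    then obtain v where "v \<in> laurent_series S" "fls_const a * v = 1"
      by (auto simp: mult_units_def)
    then have "a * fls_nth v 0 = 1" "fls_nth v 0 \<in> S"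
      by (auto simp: laurent_series_def fls_eq_iff dest: spec[of _ 0])
    then show False
      using nonunit a by (auto simp: mult_units_iff)
  qed
qed

end

subsection \<open>Sets of integers that are indecomposable under addition\<close>

text \<open>Adding a singleton is a translation, so singletons act as the units and this is
  irreducibility for Minkowski sums. The empty set is ruled out too, being the sum of two empty
  sets.\<close>

definition sumset_atom :: "int set \<Rightarrow> bool" where
  "sumset_atom A \<longleftrightarrow> \<not> is_singleton A \<and>
     (\<forall>B C. A = {b + c |b c. b \<in> B \<and> c \<in> C} \<longrightarrow> is_singleton B \<or> is_singleton C)"

lemma not_singleton_obtain:
  assumes "\<not> is_singleton B" "b \<in> B"
  obtains b' where "b' \<in> B" "b' \<noteq> b"
  using assms by (auto simp: is_singleton_def)

lemma not_singletonI: "x \<in> A \<Longrightarrow> y \<in> A \<Longrightarrow> x \<noteq> y \<Longrightarrow> \<not> is_singleton A"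
  by (auto simp: is_singleton_def)

text \<open>Here \<open>m\<close> is only a lower bound and may lie outside \<open>A\<close>. A
  nontrivial decomposition makes every estimate tight, which leaves just the progression
  \<open>m\<close>, \<open>h\<close>, \<open>N\<close>; \<open>no_ap\<close> excludes it.\<close>

lemma sumset_atom_top:
  assumes "N \<in> A" "\<not> is_singleton A" "\<And>x. x \<in> A \<Longrightarrow> m \<le> x"
    and half: "\<And>x. x \<in> A \<Longrightarrow> x \<noteq> N \<Longrightarrow> 2 * x \<le> m + N"
    and no_ap: "\<And>h. m \<in> A \<Longrightarrow> h \<in> A \<Longrightarrow> 2 * h = m + N \<Longrightarrow> \<exists>x\<in>A. x \<notin> {m, h, N}"
  shows "sumset_atom A"
  unfolding sumset_atom_def
proof (intro conjI allI impI, rule assms, rule ccontr)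
  fix B C assume A: "A = {b + c |b c. b \<in> B \<and> c \<in> C}"
    and "\<not> (is_singleton B \<or> is_singleton C)"
  moreover obtain b c where bc: "b \<in> B" "c \<in> C" "N = b + c"
    using A \<open>N \<in> A\<close> by blast
  ultimately obtain b' c' where bc': "b' \<in> B" "b' \<noteq> b" "c' \<in> C" "c' \<noteq> c"
    by (metis not_singleton_obtain)
  \<comment> \<open>The numbers \<open>x + c\<close> and \<open>b + y\<close> add up to
    \<open>x + y + N\<close>, which is at least \<open>m + N\<close>, while each is at most half of
    \<open>m + N\<close>. Hence equality holds throughout.\<close>
  have key: "2 * (x + c) = m + N \<and> 2 * (b + y) = m + N \<and> x + y = m"
    if "x \<in> B" "x \<noteq> b" "y \<in> C" "y \<noteq> c" for x y
  proof -
    have "x + y \<in> A" "x + c \<in> A" "b + y \<in> A"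
      using A that bc by auto
    then have "m \<le> x + y" "2 * (x + c) \<le> m + N" "2 * (b + y) \<le> m + N"
      using assms(3) half[of "x + c"] half[of "b + y"] that bc(3) by auto
    then show ?thesis
      using bc(3) by presburger
  qed
  have "x = b'" if "x \<in> B" "x \<noteq> b" for x
    using key[OF that bc'(3,4)] key[OF bc'] by linarith
  moreover have "y = c'" if "y \<in> C" "y \<noteq> c" for y
    using key[OF bc'(1,2) that] key[OF bc'] by linarith
  ultimately have "B = {b, b'}" "C = {c, c'}"
    using bc bc' by blast+
  then have "A = {b' + c', b' + c, b + c', b + c}"
    unfolding A by blast
  moreover have "b' + c' = m" "b + c' = b' + c" "b + c = N"
    using key[OF bc'] bc by auto
  ultimately have "A = {m, b' + c, N}"
    by auto
  then show False
    using no_ap[of "b' + c"] key[OF bc'] by blast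
qed

lemma sumset_atom_uminus:
  assumes "sumset_atom (uminus ` A)"
  shows "sumset_atom A"
proof -
  have single: "is_singleton (uminus ` B) \<longleftrightarrow> is_singleton B" for B :: "int set"
    by (simp add: is_singleton_altdef card_image)
  have "is_singleton B \<or> is_singleton C" if S: "A = {b + c |b c. b \<in> B \<and> c \<in> C}" for B C
  proof -
    have "uminus ` A = {b + c |b c. b \<in> uminus ` B \<and> c \<in> uminus ` C}"
    proof (intro equalityI subsetI)
      fix x assume "x \<in> uminus ` A"
      then obtain b c where "b \<in> B" "c \<in> C" "x = - b + - c"
        unfolding S by auto
      then show "x \<in> {b + c |b c. b \<in> uminus ` B \<and> c \<in> uminus ` C}"
        by blast
    next
      fix x assume "x \<in> {b + c |b c. b \<in> uminus ` B \<and> c \<in> uminus ` C}"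
      then obtain b c where "b \<in> B" "c \<in> C" "x = - (b + c)"
        by auto
      then show "x \<in> uminus ` A"
        unfolding S by blast
    qed
    then show ?thesis
      using assms single unfolding sumset_atom_def by blast
  qed
  then show ?thesis
    using assms single unfolding sumset_atom_def by blast
qed

text \<open>Mirror image of \<open>sumset_atom_top\<close> under negation.\<close>

lemma sumset_atom_bottom:
  assumes "m \<in> A" "\<not> is_singleton A" "\<And>x. x \<in> A \<Longrightarrow> x \<le> N"
    and "\<And>x. x \<in> A \<Longrightarrow> x \<noteq> m \<Longrightarrow> m + N \<le> 2 * x"
    and no_ap: "\<And>h. N \<in> A \<Longrightarrow> h \<in> A \<Longrightarrow> 2 * h = m + N \<Longrightarrow> \<exists>x\<in>A. x \<notin> {m, h, N}"
  shows "sumset_atom A"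
proof (rule sumset_atom_uminus, rule sumset_atom_top[of "-m" _ "-N"])
  show "\<not> is_singleton (uminus ` A)"
    using assms(2) by (simp add: is_singleton_altdef card_image)
  fix h assume "-N \<in> uminus ` A" "h \<in> uminus ` A" "2 * h = -N + -m"
  then have "N \<in> A" "-h \<in> A" "2 * -h = m + N"
    by auto
  then have "\<exists>x\<in>A. x \<notin> {m, -h, N}"
    by (rule no_ap)
  then obtain x where "x \<in> A" "x \<notin> {m, -h, N}"
    by blast
  then show "\<exists>x\<in>uminus ` A. x \<notin> {-N, h, -m}"
    by (intro bexI[of _ "-x"]) auto
qed (use assms in force)+

text \<open>All elements except \<open>N\<close> lie strictly below the midpoint of \<open>m\<close>
  and \<open>N\<close>, so the exceptional progression cannot occur.\<close>

lemma sumset_atom_far: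
  assumes "N \<in> A" "m \<in> A" "m \<le> K" "2 * K < m + N"
    and A: "\<And>x. x \<in> A \<Longrightarrow> m \<le> x \<and> (x = N \<or> x \<le> K)"
  shows "sumset_atom A"
proof (rule sumset_atom_top[of N _ m])
  show "\<not> is_singleton A"
    using assms by (intro not_singletonI[of N _ m]) auto
qed (use assms in force)+

lemma sumset_atom_pair:
  assumes "a \<noteq> b"
  shows "sumset_atom {a, b}"
proof -
  have "sumset_atom {a, b}" if "a < b" for a b
    by (rule sumset_atom_top[of b _ a]) (use that in \<open>auto simp: is_singleton_def\<close>)
  from this[of a b] this[of b a] show ?thesis
    using assms by (cases "a < b") (auto simp: insert_commute)
qed

text \<open>In a decomposition, the step from \<open>p\<close> to \<open>p + d\<close> must take
  place inside one summand. A second element of the other summand would then translate this step to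
  another pair in \<open>A\<close> with difference \<open>d\<close>.\<close>

lemma sumset_atom_gap:
  assumes A: "p \<in> A" "p + d \<in> A" "0 < d" "\<And>x. x \<in> A \<Longrightarrow> x = p \<or> p + d \<le> x"
    and diff: "\<And>x. x \<in> A \<Longrightarrow> x + d \<in> A \<Longrightarrow> x = p"
  shows "sumset_atom A"
proof -
  have contra: False
    if S: "A = {b + c |b c. b \<in> B \<and> c \<in> C}" and C: "\<not> is_singleton C"
      and b: "b \<in> B" "b + d \<in> B" and c: "c \<in> C" "b + c = p" for B C b c
  proof -
    obtain y where y: "y \<in> C" "y \<noteq> c"
      using not_singleton_obtain[OF C c(1)] by blast
    then have "b + y \<in> A" "(b + d) + y \<in> A"
      using b unfolding S by blast+
    then show False
      using diff[of "b + y"] y c by (simp add: ac_simps)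
  qed
  have "is_singleton B \<or> is_singleton C" if S: "A = {b + c |b c. b \<in> B \<and> c \<in> C}" for B C
  proof (rule ccontr)
    assume nons: "\<not> (is_singleton B \<or> is_singleton C)"
    obtain b c where bc: "b \<in> B" "c \<in> C" "b + c = p"
      using A(1) unfolding S by auto
    obtain b' c' where bc': "b' \<in> B" "c' \<in> C" "b' + c' = p + d"
      using A(2) unfolding S by auto
    have "b' + c \<in> A" "b + c' \<in> A"
      using bc bc' S by auto
    \<comment> \<open>The sums \<open>b' + c\<close> and \<open>b + c'\<close> total
      \<open>2 * p + d\<close>, and each is \<open>p\<close> or at least \<open>p + d\<close>; so
      exactly one of them is \<open>p\<close>.\<close>
    then have "b' = b \<and> c' = c + d \<or> c' = c \<and> b' = b + d"
      using A(4)[of "b' + c"] A(4)[of "b + c'"] A(3) bc(3) bc'(3) by linarith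
    then consider "b' = b" "c' = c + d" | "c' = c" "b' = b + d"
      by blast
    then show False
    proof cases
      case 1
      have "A = {c + b |c b. c \<in> C \<and> b \<in> B}"
        unfolding S by (rule Collect_cong) (metis add.commute)
      then show False
        using contra[of C B c b] nons bc bc' 1 by (simp add: add.commute)
    next
      case 2
      then show False
        using contra[OF S, of b c] nons bc bc' by simp
    qed
  qed
  moreover have "\<not> is_singleton A"
    using A by (auto simp: is_singleton_def)
  ultimately show ?thesis
    unfolding sumset_atom_def by blast
qed

section \<open>Cutting a finite set into two indecomposable pieces\<close>

text \<open>The flags \<open>\<alpha>\<close> and \<open>\<beta>\<close> say whether the endpoint
  \<open>a\<close> or \<open>b\<close> has a nonzero remainder, which then joins the opposite
  piece.\<close>

lemma partition_finite:
  assumes I: "\<And>x. x \<in> I \<Longrightarrow> a < x \<and> x < b" and card: "2 \<le> card I"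
  obtains L U where "L \<union> U = I" "L \<inter> U = {}"
    "sumset_atom (L \<union> {b} \<union> (if \<alpha> then {a} else {}))"
    "sumset_atom (U \<union> {a} \<union> (if \<beta> then {b} else {}))"
proof -
  have fin: "finite I" "I \<noteq> {}"
    using card by (auto intro: card_ge_0_finite)
  then have ab: "a < b"
    using I by fastforce
  have other: "\<exists>x\<in>I. x \<noteq> h" for h
  proof (rule ccontr)
    assume "\<not> (\<exists>x\<in>I. x \<noteq> h)"
    then have "I \<subseteq> {h}"
      by blast
    then show False
      using card card_mono[of "{h}" I] by simp
  qed
  show thesis
  proof (cases "(\<exists>l\<in>I. 2 * l < a + b) \<and> (\<exists>u\<in>I. a + b < 2 * u)")
    case True
    \<comment> \<open>Being off the midpoint, \<open>l\<close> and \<open>u\<close> are the extra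
      elements that rule out a three-term progression in their pieces.\<close>
    then obtain l u where lu: "l \<in> I" "2 * l < a + b" "u \<in> I" "a + b < 2 * u"
      by blast
    show thesis
    proof (rule that[of "{x \<in> I. 2 * x \<le> a + b}" "{x \<in> I. a + b < 2 * x}"])
      let ?L = "{x \<in> I. 2 * x \<le> a + b} \<union> {b} \<union> (if \<alpha> then {a} else {})"
      show "sumset_atom ?L"
      proof (rule sumset_atom_top[of b _ a])
        show "\<not> is_singleton ?L"
          by (rule not_singletonI[of l _ b]) (use lu I in auto)
        show "\<exists>x\<in>?L. x \<notin> {a, h, b}" if "2 * h = a + b" for h
          by (rule bexI[of _ l]) (use lu I[of l] that in auto)
      qed (use I ab in \<open>fastforce split: if_splits\<close>)+
      let ?U = "{x \<in> I. a + b < 2 * x} \<union> {a} \<union> (if \<beta> then {b} else {})"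
      show "sumset_atom ?U"
      proof (rule sumset_atom_bottom[of a _ b])
        show "\<not> is_singleton ?U"
          by (rule not_singletonI[of u _ a]) (use lu I in auto)
        show "\<exists>x\<in>?U. x \<notin> {a, h, b}" if "2 * h = a + b" for h
          by (rule bexI[of _ u]) (use lu I[of u] that in auto)
      qed (use I ab in \<open>fastforce split: if_splits\<close>)+
    qed auto
  next
    case False
    then consider "\<forall>x\<in>I. a + b \<le> 2 * x" | "\<forall>x\<in>I. 2 * x \<le> a + b"
      by force
    then show thesis
    proof cases
      case 1
      have "Min I < b" "Min I \<in> I"
        using fin I by auto
      \<comment> \<open>The piece of \<open>b\<close> is made a pair: with \<open>\<alpha>\<close>
        it already contains \<open>a\<close>, otherwise \<open>Min I\<close> is the partner.\<close>
      define L where "L = (if \<alpha> then {} else {Min I})"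
      show thesis
      proof (rule that[of L "I - L"])
        show "sumset_atom (L \<union> {b} \<union> (if \<alpha> then {a} else {}))"
          using sumset_atom_pair[of a b] ab sumset_atom_pair[of "Min I" b] \<open>Min I < b\<close> by (simp add: L_def insert_commute)
        let ?U = "I - L \<union> {a} \<union> (if \<beta> then {b} else {})"
        obtain x where x: "x \<in> I - L"
          using other[of "Min I"] fin by (cases \<alpha>) (auto simp: L_def)
        show "sumset_atom ?U"
        proof (rule sumset_atom_bottom[of a _ b])
          show "\<not> is_singleton ?U"
            by (rule not_singletonI[of x _ a]) (use x I in auto)
          fix h assume h: "h \<in> ?U" "2 * h = a + b"
          then have "h \<in> I - L"
            using ab by (auto split: if_splits)
          \<comment> \<open>A midpoint \<open>h\<close> in the upper piece can only be
            \<open>Min I\<close>. Then \<open>L\<close> is empty, and a second element of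
            \<open>I\<close> breaks the progression.\<close>
          moreover have "h \<le> Min I"
            using 1 \<open>Min I \<in> I\<close> h by force
          ultimately have "L = {}"
            using Min_le[OF fin(1), of h] by (cases \<alpha>) (auto simp: L_def)
          then show "\<exists>x\<in>?U. x \<notin> {a, h, b}"
            using other[of h] I by fastforce
        qed (use I ab 1 in \<open>fastforce split: if_splits\<close>)+
      qed (use \<open>Min I \<in> I\<close> in \<open>auto simp: L_def\<close>)
    next
      case 2
      have "a < Max I" "Max I \<in> I"
        using fin I by auto
      \<comment> \<open>The reflected choice, with \<open>Max I\<close> as the partner of
        \<open>a\<close>.\<close>
      define U where "U = (if \<beta> then {} else {Max I})"
      show thesis
      proof (rule that[of "I - U" U])
        show "sumset_atom (U \<union> {a} \<union> (if \<beta> then {b} else {}))"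
          using sumset_atom_pair[of a b] ab sumset_atom_pair[of a "Max I"] \<open>a < Max I\<close> by (simp add: U_def insert_commute)
        let ?L = "I - U \<union> {b} \<union> (if \<alpha> then {a} else {})"
        obtain x where x: "x \<in> I - U"
          using other[of "Max I"] fin by (cases \<beta>) (auto simp: U_def)
        show "sumset_atom ?L"
        proof (rule sumset_atom_top[of b _ a])
          show "\<not> is_singleton ?L"
            by (rule not_singletonI[of x _ b]) (use x I in auto)
          fix h assume h: "h \<in> ?L" "2 * h = a + b"
          then have "h \<in> I - U"
            using ab by (auto split: if_splits)
          moreover have "Max I \<le> h"
            using 2 \<open>Max I \<in> I\<close> h by force
          ultimately have "U = {}"
            using Max_ge[OF fin(1), of h] by (cases \<beta>) (auto simp: U_def)
          then show "\<exists>x\<in>?L. x \<notin> {a, h, b}"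
            using other[of h] I by fastforce
        qed (use I ab 2 in \<open>fastforce split: if_splits\<close>)+
      qed (use \<open>Max I \<in> I\<close> in \<open>auto simp: U_def\<close>)
    qed
  qed
qed


subsection \<open>Splitting a Laurent series along its support\<close>

locale atomic_semidomain = reduced_semidomain +
  assumes atomic: "add_atomic S" and atoms_eq_units: "add_atoms S = mult_units S"
begin

text \<open>The unit is the first atom of an additive decomposition. Knowing exactly when
  \<open>r\<close> vanishes later determines the supports of the pieces exactly.\<close>

lemma split_unit:
  assumes "s \<in> S" "s \<noteq> 0"
  obtains u r where "u \<in> mult_units S" "r \<in> S" "s = u + r" "r = 0 \<longleftrightarrow> s \<in> mult_units S"
proof (cases "s \<in> mult_units S")
  case True
  then show ?thesis
    using that[of s 0] by simp
next
  case False
  obtain as where as: "set as \<subseteq> mult_units S" "s = sum_list as"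
    using assms atomic unfolding add_atomic_def add_invertible_iff atoms_eq_units by blast
  then obtain u us where "as = u # us"
    using assms by (cases as) auto
  moreover have "mult_units S \<subseteq> S"
    by (auto simp: mult_units_iff)
  ultimately have "u \<in> mult_units S" "sum_list us \<in> S" "s = u + sum_list us"
    using as by (auto intro: sum_list_mem)
  moreover have "sum_list us \<noteq> 0"
    using False calculation by auto
  ultimately show ?thesis
    using that False by blast
qed

lemma irreducible_of_supp:
  assumes "g \<in> laurent_series S" "sumset_atom (fls_supp g)" "fls_nth g n \<in> mult_units S"
  shows "g \<in> mult_irreducibles (laurent_series S)"
proof (rule irreducibleI[OF assms(1) _ assms(3)])
  fix b c assume "b \<in> laurent_series S" "c \<in> laurent_series S" "g = b * c"
  then show "is_singleton (fls_supp b) \<or> is_singleton (fls_supp c)"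
    using assms(2) supp_mult[of b c] by (simp add: sumset_atom_def)
qed (use assms(2) in \<open>simp add: sumset_atom_def\<close>)

lemma trinomial_irreducible:
  assumes g: "g \<in> laurent_series S" "fls_supp g = {i, j, k}" "i \<noteq> j"
    and units: "\<And>n. n \<in> fls_supp g \<Longrightarrow> fls_nth g n \<in> mult_units S"
  shows "g \<in> mult_irreducibles (laurent_series S)"
proof (rule irreducibleI[of _ i])
  show "\<not> is_singleton (fls_supp g)"
    using g by (auto simp: is_singleton_def)
  show "fls_nth g i \<in> mult_units S"
    using units g(2) by blast
  fix b c assume bc: "b \<in> laurent_series S" "c \<in> laurent_series S" "g = b * c"
  have supp: "fls_supp g = {i + j |i j. i \<in> fls_supp b \<and> j \<in> fls_supp c}"
    using supp_mult bc by simp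
  show "is_singleton (fls_supp b) \<or> is_singleton (fls_supp c)"
  proof (rule ccontr)
    assume nons: "\<not> (is_singleton (fls_supp b) \<or> is_singleton (fls_supp c))"
    have sum: "x + y \<in> {i, j, k}" if "x \<in> fls_supp b" "y \<in> fls_supp c" for x y
      using that supp g(2) by blast
    have less: "\<exists>x\<in>X. \<exists>y\<in>X. x < y" if "\<not> is_singleton X" "X \<noteq> {}" for X :: "int set"
      using that by (metis is_singletonI' linorder_less_linear)
    have "fls_supp b \<noteq> {}" "fls_supp c \<noteq> {}"
      using supp g(2) by auto
    then obtain b1 b2 c1 c2 where
      *: "b1 \<in> fls_supp b" "b2 \<in> fls_supp b" "b1 < b2"
         "c1 \<in> fls_supp c" "c2 \<in> fls_supp c" "c1 < c2"
      using nons less by meson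
    \<comment> \<open>Both middle sums lie strictly between \<open>b1 + c1\<close> and
      \<open>b2 + c2\<close>; with only three exponents available they coincide.\<close>
    have "b1 + c2 = b2 + c1"
      using sum[OF *(1,4)] sum[OF *(1,5)] sum[OF *(2,4)] sum[OF *(2,5)] *(3,6) by auto
    then have "fls_nth g (b1 + c2) \<notin> add_atoms S"
      using nth_mult_not_atom[OF bc(1,2) _ _ *(1,2,5,4)] *(3) bc(3) by simp
    moreover have "b1 + c2 \<in> fls_supp g"
      unfolding g(2) using sum *(1,5) by blast
    ultimately show False
      using units atoms_eq_units by auto
  qed
qed (rule g)

text \<open>Each pivot coefficient is a unit plus a remainder: the unit stays in the piece of its colour
  and makes it irreducible, the remainder is moved to another piece.\<close>

lemma sum_of_irreducibles_by_colouring: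
  fixes c :: "int \<Rightarrow> nat" and p :: "nat \<Rightarrow> int" and \<sigma> :: "nat \<Rightarrow> nat"
  assumes f: "f \<in> laurent_series S"
    and c: "\<And>n. n \<in> fls_supp f \<Longrightarrow> c n < k"
    and p: "\<And>i. i < k \<Longrightarrow> p i \<in> fls_supp f \<and> c (p i) = i"
    and \<sigma>: "\<And>i. i < k \<Longrightarrow> \<sigma> i < k \<and> (\<sigma> i = i \<longrightarrow> fls_nth f (p i) \<in> mult_units S)"
    and atom: "\<And>i. i < k \<Longrightarrow> sumset_atom ({n \<in> fls_supp f. c n = i} \<union>
      {p j |j. j < k \<and> \<sigma> j = i \<and> fls_nth f (p j) \<notin> mult_units S})"
  shows "sum_of_at_most_irreducibles k (laurent_series S) f"
proof -
  have "\<exists>s. fst s \<in> mult_units S \<and> snd s \<in> S \<and> fls_nth f (p i) = fst s + snd s \<and>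
      (snd s = 0 \<longleftrightarrow> fls_nth f (p i) \<in> mult_units S)" if "i < k" for i
  proof -
    have "fls_nth f (p i) \<in> S" "fls_nth f (p i) \<noteq> 0"
      using p[OF that] f by (auto simp: fls_supp_def laurent_series_def)
    then show ?thesis
      using split_unit by (metis fst_conv snd_conv)
  qed
  then obtain s where s: "\<And>i. i < k \<Longrightarrow> fst (s i) \<in> mult_units S \<and> snd (s i) \<in> S \<and>
      fls_nth f (p i) = fst (s i) + snd (s i) \<and> (snd (s i) = 0 \<longleftrightarrow> fls_nth f (p i) \<in> mult_units S)"
    by metis
  define u where "u i = fst (s i)" for i
  define r where "r i = snd (s i)" for i
  have ur: "u i \<in> mult_units S \<and> r i \<in> S \<and> fls_nth f (p i) = u i + r i \<and>
      (r i = 0 \<longleftrightarrow> fls_nth f (p i) \<in> mult_units S)" if "i < k" for i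
    using s[OF that] by (simp add: u_def r_def)
  \<comment> \<open>\<open>X i\<close> is the part of \<open>f\<close> of colour \<open>i\<close>
    with its pivot coefficient cut down to the unit; \<open>Y i\<close> collects the remainders sent
    to \<open>i\<close> by \<open>\<sigma>\<close>.\<close>
  define X where "X i n = (if n \<in> fls_supp f \<and> c n = i then
    if n = p i then u i else fls_nth f n else 0)" for i n
  define Y where "Y i n = (if n \<in> fls_supp f \<and> n = p (c n) \<and> \<sigma> (c n) = i then r (c n) else 0)" for i n
  define g where "g i = Abs_fls (\<lambda>n. X i n + Y i n)" for i
  have g_nth: "fls_nth (g i) n = X i n + Y i n" for i n
    unfolding g_def
    by (subst nth_Abs_fls_lower_bound[of "fls_subdegree f"]) (auto simp: X_def Y_def fls_supp_def)
  have XY: "X i n \<in> S" "Y i n \<in> S" if "i < k" for i n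
    using ur c that f by (auto simp: X_def Y_def laurent_series_def mult_units_iff)
  have "g i \<in> mult_irreducibles (laurent_series S)" if "i < k" for i
  proof (rule irreducible_of_supp)
    show "g i \<in> laurent_series S"
      using XY that by (auto simp: laurent_series_def g_nth add_mem)
    have "X i n \<noteq> 0 \<longleftrightarrow> n \<in> fls_supp f \<and> c n = i" for n
      using ur[OF that] by (auto simp: X_def fls_supp_def mult_units_def)
    moreover have "Y i n \<noteq> 0 \<longleftrightarrow> n \<in> {p j |j. j < k \<and> \<sigma> j = i \<and> fls_nth f (p j) \<notin> mult_units S}" for n
      using ur p c unfolding Y_def by auto
    ultimately have "fls_supp (g i) = {n \<in> fls_supp f. c n = i} \<union>
      {p j |j. j < k \<and> \<sigma> j = i \<and> fls_nth f (p j) \<notin> mult_units S}"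
      using add_eq_0_iff[OF XY[OF that]] unfolding fls_supp_def g_nth by blast
    then show "sumset_atom (fls_supp (g i))"
      using atom[OF that] by simp
    \<comment> \<open>A remainder may stay in its own piece only if it is \<open>0\<close>, so the
      pivot coefficient of \<open>g i\<close> is still the unit.\<close>
    have "Y i (p i) = 0"
      using ur[OF that] p[OF that] \<sigma>[OF that] by (auto simp: Y_def)
    then show "fls_nth (g i) (p i) \<in> mult_units S"
      using ur[OF that] p[OF that] by (auto simp: g_nth X_def)
  qed
  moreover have "f = sum_list (map g [0..<k])"
  proof -
    have "fls_nth f n = (\<Sum>i<k. X i n + Y i n)" for n
    proof (cases "n \<in> fls_supp f")
      case True
      have "(\<Sum>i<k. X i n) = (if n = p (c n) then u (c n) else fls_nth f n)"
        using True c by (simp add: X_def)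
      moreover have "(\<Sum>i<k. Y i n) = (if n = p (c n) then r (c n) else 0)"
        using True c \<sigma> by (auto simp: Y_def)
      ultimately show ?thesis
        using ur[of "c n"] c[OF True] by (auto simp: sum.distrib)
    qed (auto simp: X_def Y_def fls_supp_def)
    then show ?thesis
      by (simp add: fls_eq_iff fls_nth_sum g_nth interv_sum_list_conv_sum_set_nat atLeast0LessThan)
  qed
  ultimately show ?thesis
    unfolding sum_of_at_most_irreducibles_def by (intro exI[of _ "map g [0..<k]"]) auto
qed

lemma sum_of_irreducibles_mono:
  "sum_of_at_most_irreducibles k T f \<Longrightarrow> k \<le> l \<Longrightarrow> sum_of_at_most_irreducibles l T f"
  unfolding sum_of_at_most_irreducibles_def by (metis order_trans)

lemma irreducible_sum_of_irreducibles:
  assumes "f \<in> mult_irreducibles T"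
  shows "sum_of_at_most_irreducibles 1 T f"
  unfolding sum_of_at_most_irreducibles_def using assms by (intro exI[of _ "[f]"]) auto

section \<open>Series with finite support\<close>

text \<open>Without a unit coefficient, the two remainders are swapped, so that both pieces have
  support \<open>{a, b}\<close>.\<close>

lemma binomial_sum:
  assumes f: "f \<in> laurent_series S" and supp: "fls_supp f = {a, b}" "a \<noteq> b"
  shows "sum_of_at_most_irreducibles 2 (laurent_series S) f"
proof (cases "fls_nth f a \<in> mult_units S \<or> fls_nth f b \<in> mult_units S")
  case True
  then have "f \<in> mult_irreducibles (laurent_series S)"
    using irreducible_of_supp[OF f] supp sumset_atom_pair by auto
  then show ?thesis
    using irreducible_sum_of_irreducibles sum_of_irreducibles_mono by fastforce
next
  case False
  let ?p = "\<lambda>i::nat. if i = 0 then a else b"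
  let ?\<sigma> = "\<lambda>i::nat. 1 - i"
  show ?thesis
  proof (rule sum_of_irreducibles_by_colouring[OF f, where c = "\<lambda>n. if n = a then 0 else 1" and p = ?p and \<sigma> = ?\<sigma>])
    fix i :: nat assume "i < 2"
    then have "{n \<in> fls_supp f. (if n = a then 0 else 1) = i} \<union>
        {?p j |j. j < 2 \<and> ?\<sigma> j = i \<and> fls_nth f (?p j) \<notin> mult_units S} = {a, b}"
      using False supp by (auto simp: less_2_cases_iff)
    then show "sumset_atom ({n \<in> fls_supp f. (if n = a then 0 else 1) = i} \<union>
        {?p j |j. j < 2 \<and> ?\<sigma> j = i \<and> fls_nth f (?p j) \<notin> mult_units S})"
      using sumset_atom_pair supp by simp
  qed (use supp in \<open>auto simp: less_2_cases_iff\<close>)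
qed

text \<open>The remainder at \<open>x\<close> joins \<open>z\<close>, which has none itself: the
  pieces have supports \<open>{x, y}\<close> and \<open>{x, z}\<close>.\<close>

lemma trinomial_sum_mixed:
  assumes f: "f \<in> laurent_series S" and supp: "fls_supp f = {x, y, z}" "x \<noteq> y" "x \<noteq> z" "y \<noteq> z"
    and units: "fls_nth f x \<notin> mult_units S" "fls_nth f z \<in> mult_units S"
  shows "sum_of_at_most_irreducibles 2 (laurent_series S) f"
proof -
  let ?p = "\<lambda>i::nat. if i = 0 then x else z"
  let ?\<sigma> = "\<lambda>i::nat. 1 - i"
  show ?thesis
  proof (rule sum_of_irreducibles_by_colouring[OF f, where c = "\<lambda>n. if n = z then 1 else 0" and p = ?p and \<sigma> = ?\<sigma>])
    fix i :: nat assume "i < 2"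
    then have "{n \<in> fls_supp f. (if n = z then 1 else 0) = i} \<union>
        {?p j |j. j < 2 \<and> ?\<sigma> j = i \<and> fls_nth f (?p j) \<notin> mult_units S} = (if i = 0 then {x, y} else {x, z})"
      using units supp by (auto simp: less_2_cases_iff)
    then show "sumset_atom ({n \<in> fls_supp f. (if n = z then 1 else 0) = i} \<union>
        {?p j |j. j < 2 \<and> ?\<sigma> j = i \<and> fls_nth f (?p j) \<notin> mult_units S})"
      using sumset_atom_pair supp by simp
  qed (use supp in \<open>auto simp: less_2_cases_iff\<close>)
qed

text \<open>Rotating the three remainders cyclically gives three pieces with two exponents
  each.\<close>

lemma trinomial_sum_nonunits:
  assumes f: "f \<in> laurent_series S" and supp: "fls_supp f = {x, y, z}" "x \<noteq> y" "x \<noteq> z" "y \<noteq> z"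
    and units: "\<And>n. n \<in> fls_supp f \<Longrightarrow> fls_nth f n \<notin> mult_units S"
  shows "sum_of_at_most_irreducibles 3 (laurent_series S) f"
proof -
  let ?c = "\<lambda>n. if n = x then 0 else if n = y then 1 else 2 :: nat"
  let ?p = "\<lambda>i::nat. if i = 0 then x else if i = 1 then y else z"
  let ?\<sigma> = "\<lambda>i::nat. if i = 0 then 1 else if i = 1 then 2 else 0 :: nat"
  have less_3: "i < 3 \<longleftrightarrow> i = 0 \<or> i = 1 \<or> i = 2" for i :: nat
    by auto
  show ?thesis
  proof (rule sum_of_irreducibles_by_colouring[OF f, where c = ?c and p = ?p and \<sigma> = ?\<sigma>])
    fix i :: nat assume "i < 3"
    then have "{n \<in> fls_supp f. ?c n = i} \<union>
        {?p j |j. j < 3 \<and> ?\<sigma> j = i \<and> fls_nth f (?p j) \<notin> mult_units S} =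
        (if i = 0 then {x, z} else if i = 1 then {x, y} else {y, z})"
      using units supp unfolding less_3 by (auto split: if_splits)
    then show "sumset_atom ({n \<in> fls_supp f. ?c n = i} \<union>
        {?p j |j. j < 3 \<and> ?\<sigma> j = i \<and> fls_nth f (?p j) \<notin> mult_units S})"
      using sumset_atom_pair supp by simp
  qed (use supp in \<open>auto simp: less_3\<close>)
qed

lemma trinomial_sum:
  assumes f: "f \<in> laurent_series S" and card: "card (fls_supp f) = 3"
  shows "sum_of_at_most_irreducibles 3 (laurent_series S) f"
proof -
  obtain x y z where supp: "fls_supp f = {x, y, z}" "x \<noteq> y" "x \<noteq> z" "y \<noteq> z"
    using card by (auto simp: card_3_iff)
  consider "\<forall>n\<in>fls_supp f. fls_nth f n \<in> mult_units S" | "\<forall>n\<in>fls_supp f. fls_nth f n \<notin> mult_units S"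
    | i k where "i \<in> fls_supp f" "k \<in> fls_supp f" "fls_nth f i \<notin> mult_units S" "fls_nth f k \<in> mult_units S"
    by blast
  then show ?thesis
  proof cases
    case 1
    then have "f \<in> mult_irreducibles (laurent_series S)"
      by (intro trinomial_irreducible[OF f supp(1,2)]) blast
    then show ?thesis
      using irreducible_sum_of_irreducibles sum_of_irreducibles_mono by fastforce
  next
    case 2
    then show ?thesis
      using trinomial_sum_nonunits[OF f supp] by blast
  next
    case 3
    then have "i \<noteq> k"
      by auto
    then obtain j where "fls_supp f = {i, j, k}" "i \<noteq> j" "j \<noteq> k"
      using 3(1,2) supp by auto
    then have "sum_of_at_most_irreducibles 2 (laurent_series S) f"
      using trinomial_sum_mixed[OF f] \<open>i \<noteq> k\<close> 3(3,4) by blast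
    then show ?thesis
      by (rule sum_of_irreducibles_mono) simp
  qed
qed

lemma finite_supp_sum:
  assumes f: "f \<in> laurent_series S" and fin: "finite (fls_supp f)" and card: "4 \<le> card (fls_supp f)"
  shows "sum_of_at_most_irreducibles 2 (laurent_series S) f"
proof -
  let ?A = "fls_supp f"
  define a where "a = Min ?A"
  define b where "b = Max ?A"
  have "?A \<noteq> {}"
    using card by auto
  then have ab: "a \<in> ?A" "b \<in> ?A" "\<And>x. x \<in> ?A \<Longrightarrow> a \<le> x \<and> x \<le> b"
    using fin by (auto simp: a_def b_def)
  have "card {a, b} \<le> 2"
    by (simp add: card_insert_if)
  then have cardI: "2 \<le> card (?A - {a, b})"
    using card ab by (subst card_Diff_subset) auto
  then obtain L U where LU: "L \<union> U = ?A - {a, b}" "L \<inter> U = {}"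
    "sumset_atom (L \<union> {b} \<union> (if fls_nth f a \<notin> mult_units S then {a} else {}))"
    "sumset_atom (U \<union> {a} \<union> (if fls_nth f b \<notin> mult_units S then {b} else {}))"
    using partition_finite[of "?A - {a, b}" a b] ab by (metis (no_types, lifting) DiffD1 DiffD2 insertCI order_le_less)
  have "a \<noteq> b"
  proof
    assume "a = b"
    then have "?A = {a}"
      using ab by force
    then show False
      using card by simp
  qed
  let ?c = "\<lambda>n. if n \<in> L \<union> {b} then 0 else 1 :: nat"
  let ?p = "\<lambda>i::nat. if i = 0 then b else a"
  let ?\<sigma> = "\<lambda>i::nat. 1 - i"
  show ?thesis
  proof (rule sum_of_irreducibles_by_colouring[OF f, where c = ?c and p = ?p and \<sigma> = ?\<sigma>])
    fix i :: nat assume "i < 2"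
    then have "{n \<in> ?A. ?c n = i} \<union>
        {?p j |j. j < 2 \<and> ?\<sigma> j = i \<and> fls_nth f (?p j) \<notin> mult_units S} =
      (if i = 0 then L \<union> {b} \<union> (if fls_nth f a \<notin> mult_units S then {a} else {})
       else U \<union> {a} \<union> (if fls_nth f b \<notin> mult_units S then {b} else {}))"
      using LU(1,2) ab(1,2) \<open>a \<noteq> b\<close> by (auto simp: less_2_cases_iff)
    then show "sumset_atom ({n \<in> ?A. ?c n = i} \<union>
        {?p j |j. j < 2 \<and> ?\<sigma> j = i \<and> fls_nth f (?p j) \<notin> mult_units S})"
      using LU(3,4) by simp
  qed (use LU(1) ab(1,2) \<open>a \<noteq> b\<close> in \<open>auto simp: less_2_cases_iff\<close>)
qed

section \<open>Series with infinite support\<close>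

lemma infinite_supp_sum:
  assumes f: "f \<in> laurent_series S" and inf: "infinite (fls_supp f)"
  shows "sum_of_at_most_irreducibles 3 (laurent_series S) f"
proof -
  let ?A = "fls_supp f"
  define m where "m = fls_subdegree f"
  have "f \<noteq> 0"
    using inf by (auto simp: fls_supp_def)
  then have m: "m \<in> ?A" "\<And>x. x \<in> ?A \<Longrightarrow> m \<le> x"
    by (auto simp: m_def fls_supp_def fls_subdegree_leI)
  have unbounded: "\<exists>n\<in>B. K < n" if "infinite B" "B \<subseteq> ?A" for B K
  proof (rule ccontr)
    assume "\<not> (\<exists>n\<in>B. K < n)"
    then have "B \<subseteq> {m..K}"
      using m that by fastforce
    then show False
      using that finite_subset by blast
  qed
  \<comment> \<open>Choosing \<open>p\<close> above \<open>m\<close> keeps \<open>m\<close>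
    available for the piece of colour \<open>0\<close>.\<close>
  obtain p where p: "p \<in> ?A" "m < p"
    using unbounded[OF inf] by blast
  obtain p' where p': "p' \<in> ?A" "p < p'"
    using unbounded[OF inf] by blast
  define d where "d = p' - p"
  have d: "0 < d" "p + d \<in> ?A"
    using p' by (auto simp: d_def)
  let ?D = "{n \<in> ?A. n + d \<in> ?A}"
  show ?thesis
  proof (cases "finite ?D")
    case True
    \<comment> \<open>Beyond \<open>K\<close> no two elements of the support differ by
      \<open>d\<close>, and \<open>p + d\<close> has no partner there either, as
      \<open>p + 2 * d \<le> K\<close>.\<close>
    obtain K where K: "p + 2 * d \<le> K" "\<And>x. x \<in> ?D \<Longrightarrow> x \<le> K"
      using True that[of "Max (insert (p + 2 * d) ?D)"] by auto
    \<comment> \<open>The bound \<open>2 * K - m\<close> is the one that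
      \<open>sumset_atom_far\<close> asks for.\<close>
    obtain N where N: "N \<in> ?A" "max K (2 * K - m) < N"
      using unbounded[OF inf] by blast
    let ?c = "\<lambda>n. if n = N then 0 else if n = p \<or> n = p + d then 1 else if n \<le> K then 0 else 1 :: nat"
    let ?p = "\<lambda>i::nat. if i = 0 then N else p"
    let ?\<sigma> = "\<lambda>i::nat. 1 - i"
    \<comment> \<open>Remainders respect the shape of the pieces: the one at \<open>p\<close> lies
      below \<open>K\<close> and goes to colour \<open>0\<close>, the one at \<open>N\<close> lies
      beyond \<open>K\<close> and goes to the tail.\<close>
    define P where "P i = {n \<in> ?A. ?c n = i} \<union>
        {?p j |j. j < 2 \<and> ?\<sigma> j = i \<and> fls_nth f (?p j) \<notin> mult_units S}" for i
    have "sum_of_at_most_irreducibles 2 (laurent_series S) f"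
    proof (rule sum_of_irreducibles_by_colouring[OF f, where c = ?c and p = ?p and \<sigma> = ?\<sigma>])
      have P0: "n \<in> ?A \<and> (n = N \<or> n \<le> K)" if "n \<in> P 0" for n
        using that p N K d by (auto simp: P_def less_2_cases_iff split: if_splits)
      have "N \<in> P 0" "m \<in> P 0"
        using N m p d K by (auto simp: P_def)
      then have "sumset_atom (P 0)"
        using p d K N m(2) P0 by (intro sumset_atom_far[of N _ m K]) auto
      have P1: "n \<in> ?A \<and> (n = p \<or> n = p + d \<or> K < n)" if "n \<in> P 1" for n
        using that p N K d by (auto simp: P_def less_2_cases_iff split: if_splits)
      have "p \<in> P 1" "p + d \<in> P 1"
        using N p d K by (auto simp: P_def)
      moreover have "x = p" if x: "x \<in> P 1" "x + d \<in> P 1" for x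
        using P1[OF x(1)] P1[OF x(2)] K(1) K(2)[of x] d(1) by auto
      moreover have "x = p \<or> p + d \<le> x" if "x \<in> P 1" for x
        using P1[OF that] K(1) d(1) by auto
      ultimately have "sumset_atom (P 1)"
        using d(1) sumset_atom_gap[of p "P 1" d] by blast
      with \<open>sumset_atom (P 0)\<close> have "sumset_atom (P i)" if "i < 2" for i
        using that by (auto simp: less_2_cases_iff)
      then show "sumset_atom ({n \<in> ?A. ?c n = i} \<union>
          {?p j |j. j < 2 \<and> ?\<sigma> j = i \<and> fls_nth f (?p j) \<notin> mult_units S})" if "i < 2" for i
        using that unfolding P_def .
    qed (use N p d K in \<open>auto simp: less_2_cases_iff\<close>)
    then show ?thesis
      by (rule sum_of_irreducibles_mono) simp
  next
    case False
    then obtain q where "q \<in> ?D" and q: "p + d < q"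
      using unbounded[of ?D] by blast
    then have qA: "q \<in> ?A" "q + d \<in> ?A"
      by auto
    \<comment> \<open>With this bound, \<open>p + d\<close> and \<open>q + d\<close> have no partner
      at distance \<open>d\<close> in the tail.\<close>
    define K where "K = q + 2 * d"
    obtain N where N: "N \<in> ?A" "max K (2 * K - m) < N"
      using unbounded[OF inf] by blast
    let ?c = "\<lambda>n. if n = N then 0 else if n = p \<or> n = p + d then 1 else if n = q \<or> n = q + d then 2
      else if n \<le> K then 0 else if even (n div d) then 1 else 2 :: nat"
    let ?p = "\<lambda>i::nat. if i = 0 then N else if i = 1 then p else q"
    \<comment> \<open>The remainder at \<open>N\<close> goes to the tail of matching parity, so that
      neither tail acquires a pair at distance \<open>d\<close>.\<close>
    let ?\<sigma> = "\<lambda>i::nat. if i = 0 then if even (N div d) then 1 else 2 else 0 :: nat"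
    define P where "P i = {n \<in> ?A. ?c n = i} \<union>
        {?p j |j. j < 3 \<and> ?\<sigma> j = i \<and> fls_nth f (?p j) \<notin> mult_units S}" for i
    have less_3: "i < 3 \<longleftrightarrow> i = 0 \<or> i = 1 \<or> i = 2" for i :: nat
      by auto
    have order: "m < p" "p < p + d" "p + d < q" "q < q + d" "q + d < K" "K < N" "2 * K < m + N"
      using p d q N by (auto simp: K_def)
    \<comment> \<open>Shifting by \<open>d\<close> flips the parity of the quotient, so two tail
      elements at distance \<open>d\<close> get different colours.\<close>
    have step: "(n + d) div d = n div d + 1" for n
      using d by simp
    show ?thesis
    proof (rule sum_of_irreducibles_by_colouring[OF f, where c = ?c and p = ?p and \<sigma> = ?\<sigma>])
      have P0: "n \<in> ?A \<and> (n = N \<or> n \<le> K)" if "n \<in> P 0" for n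
        using that p qA N order by (auto simp: P_def less_3 split: if_splits)
      have "N \<in> P 0" "m \<in> P 0"
        using N m order by (auto simp: P_def)
      then have "sumset_atom (P 0)"
        using order m(2) P0 by (intro sumset_atom_far[of N _ m K]) auto
      have P1: "n = p \<or> n = p + d \<or> (K < n \<and> even (n div d))" if "n \<in> P 1" for n
        using that order by (auto simp: P_def less_3 split: if_splits)
      have "p \<in> P 1" "p + d \<in> P 1"
        using p d order by (auto simp: P_def)
      moreover have "x = p" if x: "x \<in> P 1" "x + d \<in> P 1" for x
        using P1[OF x(1)] P1[OF x(2)] step[of x] order by (auto simp: K_def)
      moreover have "x = p \<or> p + d \<le> x" if "x \<in> P 1" for x
        using P1[OF that] order by auto
      ultimately have "sumset_atom (P 1)"
        using d(1) sumset_atom_gap[of p "P 1" d] by blast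
      have P2: "n = q \<or> n = q + d \<or> (K < n \<and> odd (n div d))" if "n \<in> P 2" for n
        using that order by (auto simp: P_def less_3 split: if_splits)
      have "q \<in> P 2" "q + d \<in> P 2"
        using qA order by (auto simp: P_def)
      moreover have "x = q" if x: "x \<in> P 2" "x + d \<in> P 2" for x
        using P2[OF x(1)] P2[OF x(2)] step[of x] order by (auto simp: K_def)
      moreover have "x = q \<or> q + d \<le> x" if "x \<in> P 2" for x
        using P2[OF that] order by auto
      ultimately have "sumset_atom (P 2)"
        using d(1) sumset_atom_gap[of q "P 2" d] by blast
      with \<open>sumset_atom (P 0)\<close> \<open>sumset_atom (P 1)\<close> have "sumset_atom (P i)" if "i < 3" for i
        using that by (auto simp: less_3)
      then show "sumset_atom ({n \<in> ?A. ?c n = i} \<union>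
          {?p j |j. j < 3 \<and> ?\<sigma> j = i \<and> fls_nth f (?p j) \<notin> mult_units S})" if "i < 3" for i
        using that unfolding P_def .
    qed (use N p qA d order in \<open>auto simp: less_3\<close>)
  qed
qed

lemma sum_of_three_irreducibles:
  assumes f: "f \<in> laurent_series S" and "supp_gt_one f"
  shows "sum_of_at_most_irreducibles 3 (laurent_series S) f"
proof -
  consider "infinite (fls_supp f)" | "card (fls_supp f) = 2" | "card (fls_supp f) = 3"
    | "finite (fls_supp f)" "4 \<le> card (fls_supp f)"
    using assms(2) unfolding supp_gt_one_def by linarith
  then show ?thesis
  proof cases
    case 2
    then obtain a b where "fls_supp f = {a, b}" "a \<noteq> b"
      by (auto simp: card_2_iff)
    then show ?thesis
      using binomial_sum[OF f] sum_of_irreducibles_mono by fastforce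
  next
    case 4
    then show ?thesis
      using finite_supp_sum[OF f] sum_of_irreducibles_mono by fastforce
  qed (use infinite_supp_sum trinomial_sum f in auto)
qed

end

theorem theorem4p4:
  fixes S :: "'a::idom set"
  assumes "semidomain S" and "add_reduced S" and "add_atomic S"
  shows "(add_atoms S = mult_units S \<longleftrightarrow>
            (\<forall>f \<in> laurent_series S. supp_gt_one f \<longrightarrow>
               sum_of_at_most_irreducibles 3 (laurent_series S) f)) \<and>
         ((\<forall>f \<in> laurent_series S. supp_gt_one f \<longrightarrow>
               sum_of_at_most_irreducibles 3 (laurent_series S) f) \<longleftrightarrow>
            (\<exists>k>0. \<forall>f \<in> laurent_series S. supp_gt_one f \<longrightarrow>
               sum_of_at_most_irreducibles k (laurent_series S) f))"
    (is "(?atoms \<longleftrightarrow> ?sums 3) \<and> (?sums 3 \<longleftrightarrow> (\<exists>k>0. ?sums k))")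
proof -
  interpret reduced_semidomain S
    using assms by unfold_locales
  \<comment> \<open>Arbitrary \<open>k\<close> covers both the bound \<open>3\<close> and the
    existential statement, which closes the cycle of implications.\<close>
  have "?atoms" if "?sums k" for k
    using units_subset_atoms[OF assms(3)] atoms_subset_units[OF that] by blast
  moreover have "?sums 3" if ?atoms
  proof -
    interpret atomic_semidomain S
      using assms that by unfold_locales
    show ?thesis
      using sum_of_three_irreducibles by blast
  qed
  moreover have "(0::nat) < 3"
    by simp
  ultimately show ?thesis
    by blast
qed

end
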